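(* Let $A\subseteq(0,1)$ be an open set of Lebesgue measure $\alpha\in(0,1]$. Then $$ G(A) \le \begin{cases} (1-\alpha)\lfloor 1/\alpha\rfloor & \text{if } 0<\alpha\le 0.1,\\ (1-\alpha+\alpha\{1/\alpha\})\lfloor 1/\alpha\rfloor & \text{if } 0.1\le\alpha\le 0.5,\\ 2(1-\alpha) & \text{if } 0.5\le\alpha\le 1. \end{cases} $$
   Context: For a set $A$ of real numbers and an integer $h\ge 1$, $hA:=\{a_1+\dots+a_h\colon a_1,\dots,a_h\in A\}$ is the set of all sums of exactly $h$ (not necessarily distinct) elements of $A$, and $\mathcal S(A):=\bigcup_{h=1}^\infty hA$ is the set of all numbers representable as a finite sum of elements of $A$. For a non-empty open set $A\subseteq(0,1)$, the set $\mathcal S(A)$ contains all sufficiently large real numbers, and one defines $G(A):=\sup\{u\in\mathbb R\colon u\notin\mathcal S(A)\}$. $\lfloor x\rfloor$ denotes the integer part and $\{x\}=x-\lfloor x\rfloor$ the fractional part of a real number $x$. *)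

theory Defs
  imports "HOL-Analysis.Analysis"
begin

definition hfold_sumset :: "nat \<Rightarrow> real set \<Rightarrow> real set" where
  "hfold_sumset h A = {\<Sum>i<h. a i | a. \<forall>i<h. a i \<in> A}"

definition finite_sums :: "real set \<Rightarrow> real set" where
  "finite_sums A = (\<Union>h\<in>{1..}. hfold_sumset h A)"

(* The real supremum is meaningful only for sets that are non-empty and bounded above;
   nonrep_nonempty and bdd_above_nonrep below show that this is the case
   for non-empty open A contained in (0,1). *)
definition G :: "real set \<Rightarrow> real" where
  "G A = Sup {u. u \<notin> finite_sums A}"

lemma finite_sums_pos:
  assumes "A \<subseteq> {0<..<1}" "u \<in> finite_sums A"
  shows "u > 0"
proof -
  obtain h :: nat and a where h: "h \<ge> 1" and a: "\<forall>i<h. a i \<in> A" and u: "u = (\<Sum>i<h. a i)"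
    using assms(2) unfolding finite_sums_def hfold_sumset_def by auto
  have "(\<Sum>i<h. a i) > 0"
    using h a assms(1) by (intro sum_pos) (auto simp: lessThan_empty_iff)
  then show ?thesis using u by simp
qed

lemma nonrep_nonempty:
  assumes "A \<subseteq> {0<..<1}"
  shows "{u. u \<notin> finite_sums A} \<noteq> {}"
  using finite_sums_pos[OF assms, of 0] by auto

lemma bdd_above_nonrep:
  assumes "open A" "A \<noteq> {}" "A \<subseteq> {0<..<1}"
  shows "bdd_above {u. u \<notin> finite_sums A}"
proof -
  obtain x where x: "x \<in> A" using assms(2) by blast
  have x0: "x > 0" using x assms(3) by auto
  obtain e where e: "e > 0" "ball x e \<subseteq> A"
    using assms(1) x by (meson open_contains_ball)
  have "u \<le> x * (x / e + 2)" if nu: "u \<notin> finite_sums A" for u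
  proof (rule ccontr)
    assume "\<not> u \<le> x * (x / e + 2)"
    then have ux: "u / x > x / e + 2" using x0 by (simp add: field_simps)
    define h where "h = nat \<lfloor>u / x\<rfloor>"
    have xe: "x / e > 0" using x0 e by simp
    have fl: "real h = of_int \<lfloor>u / x\<rfloor>" using ux xe unfolding h_def by simp
    have hb: "real h \<le> u / x" "u / x < real h + 1" unfolding fl by linarith+
    have hl: "real h > x / e + 1" using hb ux by linarith
    have h0: "real h > 0" using hl xe by linarith
    have "u / h \<ge> x" using hb(1) x0 h0 by (simp add: field_simps)
    moreover have "u / h < x + x / h" using hb(2) x0 h0 by (simp add: field_simps)
    moreover have "x / h < e"
    proof -
      have "x / e < h" using hl by linarith
      then show ?thesis using e(1) h0 by (simp add: field_simps)
    qed
    ultimately have "u / h \<in> ball x e" by (simp add: dist_real_def)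
    then have uA: "u / h \<in> A" using e(2) by blast
    have "u = (\<Sum>i<h. u / h)" using h0 by simp
    then have "u \<in> hfold_sumset h A" using uA unfolding hfold_sumset_def
      by (intro CollectI exI[of _ "\<lambda>_. u / h"]) auto
    moreover have "h \<ge> 1" using h0 by linarith
    ultimately have "u \<in> finite_sums A" unfolding finite_sums_def by auto
    then show False using nu by blast
  qed
  then show ?thesis by (intro bdd_aboveI) auto
qed

end

theory Submission
  imports Defs "HOL-Computational_Algebra.Primes"
begin

text \<open>
  The set \<open>S\<close> of finite sums of \<open>A\<close> is an open semigroup of positive reals. Call \<open>y > 0\<close> a period
  of \<open>S\<close> if \<open>S + y \<subseteq> S\<close>. Elements of \<open>S\<close> are periods, and so are their positive limits because \<open>S\<close> is
  open; after rescaling, \<open>Sup A = 1\<close> is a period. For a period \<open>y\<close> let \<open>W y z\<close> be the measure of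
  \<open>S \<inter> (z - y, z)\<close>. As \<open>z\<close> grows, no residue modulo \<open>y\<close> is lost, so \<open>W y\<close> is monotone; and Raikov's
  inequality on the circle of length \<open>y\<close>, which follows from the Cauchy--Davenport theorem by
  approximation with grid cells, gives \<open>min y (W y a + W y b) \<le> W y (a + b)\<close> (\<open>W_superadd\<close>). Once
  \<open>W y a + W y b > y\<close>, the pigeonhole principle puts everything from \<open>a + b\<close> on into \<open>S\<close>
  (\<open>mem_if_W_large\<close>).

  Let \<open>k = \<lfloor>1 / \<alpha>\<rfloor>\<close> and let \<open>u\<close> be outside \<open>S\<close>. Superadditivity gives \<open>W 1 j \<ge> j \<alpha>\<close> for \<open>j \<le> k\<close>, so \<open>S\<close>
  occupies at least \<open>\<alpha> k (k + 1) / 2\<close> of \<open>(0, k)\<close>. On the other hand it occupies at most half of \<open>(0, u)\<close>,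
  since \<open>s\<close> and \<open>u - s\<close> are never both in \<open>S\<close>. Comparing the two yields \<open>u \<le> k (2 - (k + 1) \<alpha>)\<close>
  (\<open>gap_bound\<close>), which is the second bound of the theorem, and also the third since there \<open>k = 1\<close> or
  \<open>\<alpha> = 1/2\<close>.

  For \<open>k \<ge> 10\<close> suppose that \<open>u > k (1 - \<alpha>) \<ge> k - 1\<close> is outside \<open>S\<close> (\<open>sharp_gap_bound\<close>).
  If \<open>S\<close> has an element \<open>y \<le> 1/2\<close>, superadditivity for the period \<open>y\<close> says that the density of \<open>S\<close>
  grows at least linearly, so \<open>S\<close> is concentrated towards 1 within \<open>(0, 1)\<close>, and becomes full long
  before \<open>k - 1\<close> (\<open>small_element_density\<close>). Otherwise \<open>S \<inter> (0, 1)\<close> lies in \<open>(c, 1)\<close> with \<open>c \<ge> 1/2\<close> its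
  infimum, again a period. If \<open>1 - c > 3/2 \<alpha>\<close>, a Freiman-type count modulo \<open>1 - c\<close> shows
  \<open>W 1 2 \<ge> 5/2 \<alpha>\<close> (\<open>W_two_ge\<close>), and this gain also fills a period before \<open>k - 1\<close>. If not, \<open>S\<close> fills at
  least two thirds of \<open>(c, 1)\<close>, hence almost all of \<open>(n c, n)\<close> for every \<open>n \<ge> 3\<close>
  (\<open>dense_at_top_intervals\<close>), and one of these intervals contains \<open>u\<close>.
\<close>

section \<open>Raikov's inequality on the circle\<close>

definition mod_sumset :: "int \<Rightarrow> int set \<Rightarrow> int set \<Rightarrow> int set" where
  "mod_sumset p I J = {(i + j) mod p | i j. i \<in> I \<and> j \<in> J}"

lemma mod_sumset_subset: "p > 0 \<Longrightarrow> mod_sumset p I J \<subseteq> {0..<p}"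
  by (auto simp: mod_sumset_def)

lemma inj_on_mod_shift: "inj_on (\<lambda>j. (j + e) mod p) {0..<p::int}"
proof (rule inj_on_inverseI)
  fix j assume "j \<in> {0..<p}"
  then show "((j + e) mod p - e) mod p = j"
    by (simp add: mod_diff_left_eq)
qed

lemma card_le_card_mod_sumset:
  assumes "p > 0" "I \<subseteq> {0..<p}" "J \<noteq> {}"
  shows "card I \<le> card (mod_sumset p I J)"
proof -
  obtain j where j: "j \<in> J" using assms by blast
  have "(\<lambda>i. (i + j) mod p) ` I \<subseteq> mod_sumset p I J"
    using j by (auto simp: mod_sumset_def)
  moreover have "finite (mod_sumset p I J)"
    using finite_subset[OF mod_sumset_subset[OF assms(1)]] by simp
  ultimately have "card ((\<lambda>i. (i + j) mod p) ` I) \<le> card (mod_sumset p I J)"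
    by (intro card_mono)
  then show ?thesis
    using card_image[OF inj_on_subset[OF inj_on_mod_shift assms(2)]] by simp
qed

text \<open>Every residue that is nonzero modulo a prime generates, so the orbit of a single point under
  the shift already has \<open>p\<close> elements.\<close>
lemma mod_shift_invariant_full:
  fixes p :: int
  assumes "prime p" and I: "I \<subseteq> {0..<p}" "I \<noteq> {}" and d: "\<not> p dvd d"
    and inv: "\<And>i. i \<in> I \<Longrightarrow> (i + d) mod p \<in> I"
  shows "card I = nat p"
proof -
  obtain i where i: "i \<in> I" using I by blast
  have orbit: "(i + int n * d) mod p \<in> I" for n
  proof (induction n)
    case 0 then show ?case using i I by auto
  next
    case (Suc n)
    have "((i + int n * d) mod p + d) mod p = (i + int (Suc n) * d) mod p"
      by (subst mod_add_left_eq) (simp add: algebra_simps)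
    with inv[OF Suc] show ?case by simp
  qed
  have "inj_on (\<lambda>n. (i + n * d) mod p) {0..<p}"
  proof (rule inj_onI)
    fix m n assume mn: "m \<in> {0..<p}" "n \<in> {0..<p}"
      and eq: "(i + m * d) mod p = (i + n * d) mod p"
    then have "p dvd (m - n) * d"
      by (simp add: mod_eq_dvd_iff algebra_simps)
    then have "p dvd m - n"
      using d assms(1) by (auto simp: prime_dvd_mult_iff)
    then show "m = n"
      using mn by (metis atLeastLessThan_iff mod_eq_dvd_iff mod_pos_pos_trivial)
  qed
  then have "card ((\<lambda>n. (i + n * d) mod p) ` {0..<p}) = nat p"
    by (simp add: card_image)
  moreover have "(\<lambda>n. (i + n * d) mod p) ` {0..<p} \<subseteq> I"
  proof clarify
    fix n assume "n \<in> {0..<p}"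
    then show "(i + n * d) mod p \<in> I" using orbit[of "nat n"] by simp
  qed
  moreover have "finite I" using finite_subset[OF I(1)] by simp
  ultimately have "nat p \<le> card I" using card_mono by metis
  moreover have "card I \<le> card {0..<p}" using I by (intro card_mono) auto
  ultimately show ?thesis by simp
qed

text \<open>The proof is the Dyson transform: moving the translates of \<open>J\<close> that leave \<open>I\<close> over to \<open>I\<close>
  keeps the sum of the cardinalities, does not enlarge the sumset, and shrinks \<open>J\<close>. It is
  available unless \<open>I\<close> is invariant under all differences of \<open>J\<close>, and then \<open>I\<close> is everything
  or \<open>J\<close> is a single point.\<close>
lemma Cauchy_Davenport:
  fixes p :: int
  assumes p: "prime p"
  shows "\<lbrakk>I \<subseteq> {0..<p}; J \<subseteq> {0..<p}; I \<noteq> {}; J \<noteq> {}\<rbrakk>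
    \<Longrightarrow> min (nat p) (card I + card J - 1) \<le> card (mod_sumset p I J)"
proof (induction "card J" arbitrary: I J rule: less_induct)
  case less
  have p0: "p > 0" using p by (simp add: prime_gt_0_int)
  have fin: "finite I" "finite J"
    using less.prems(1,2) finite_subset[OF _ finite_atLeastLessThan_int] by simp_all
  have le: "card I \<le> card (mod_sumset p I J)"
    using card_le_card_mod_sumset[OF p0] less.prems by blast
  show ?case
  proof (cases "\<exists>i\<in>I. \<exists>j\<in>J. \<exists>j'\<in>J. (j' + (i - j)) mod p \<notin> I")
    case True
    then obtain i j j' where *: "i \<in> I" "j \<in> J" "j' \<in> J" "(j' + (i - j)) mod p \<notin> I" by blast
    define e where "e = i - j"
    define sh where "sh = (\<lambda>j. (j + e) mod p)"
    define I1 where "I1 = I \<union> sh ` J"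
    define J1 where "J1 = {j \<in> J. sh j \<in> I}"
    have sh_inj: "inj_on sh J"
      unfolding sh_def using inj_on_subset[OF inj_on_mod_shift less.prems(2)] .
    have "i \<in> {0..<p}" using * less.prems by blast
    then have jJ1: "j \<in> J1" using * by (simp add: J1_def sh_def e_def)
    have "j' \<notin> J1" using * by (simp add: J1_def sh_def e_def)
    then have "J1 \<subset> J" using * J1_def by blast
    then have smaller: "card J1 < card J" using fin by (simp add: psubset_card_mono)
    have "I \<inter> sh ` J = sh ` J1" unfolding J1_def by blast
    moreover have "card (sh ` J1) = card J1"
      using sh_inj by (intro card_image) (auto simp: J1_def intro: inj_on_subset)
    ultimately have cards: "card I1 + card J1 = card I + card J"
      unfolding I1_def using card_Un_Int[of I "sh ` J"] fin card_image[OF sh_inj] by simp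
    have "sh ` J \<subseteq> {0..<p}" using p0 by (auto simp: sh_def)
    then have "min (nat p) (card I1 + card J1 - 1) \<le> card (mod_sumset p I1 J1)"
      using less.prems jJ1 I1_def J1_def by (intro less.hyps[OF smaller]) auto
    moreover have "mod_sumset p I1 J1 \<subseteq> mod_sumset p I J"
    proof
      fix x assume "x \<in> mod_sumset p I1 J1"
      then obtain a b where ab: "a \<in> I1" "b \<in> J1" "x = (a + b) mod p"
        unfolding mod_sumset_def by blast
      show "x \<in> mod_sumset p I J"
      proof (cases "a \<in> I")
        case True
        then show ?thesis using ab J1_def unfolding mod_sumset_def by blast
      next
        case False
        then obtain c where c: "c \<in> J" "a = sh c" using ab I1_def by blast
        have "x = (sh b + c) mod p"
        proof -
          have "(c + e + b) mod p = (b + e + c) mod p" by (simp add: algebra_simps)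
          then show ?thesis using ab c by (simp add: sh_def mod_add_left_eq)
        qed
        moreover have "sh b \<in> I" using ab J1_def by blast
        ultimately show ?thesis using c unfolding mod_sumset_def by blast
      qed
    qed
    then have "card (mod_sumset p I1 J1) \<le> card (mod_sumset p I J)"
      using finite_subset[OF mod_sumset_subset[OF p0]] by (simp add: card_mono)
    ultimately show ?thesis using cards by simp
  next
    case False
    show ?thesis
    proof (cases "\<exists>j\<in>J. \<exists>j'\<in>J. j \<noteq> j'")
      case True
      then obtain j j' where jj: "j \<in> J" "j' \<in> J" "j \<noteq> j'" by blast
      have "\<not> p dvd j' - j"
        using jj less.prems(2) by (metis atLeastLessThan_iff mod_eq_dvd_iff mod_pos_pos_trivial subsetD)
      moreover have "(i + (j' - j)) mod p \<in> I" if "i \<in> I" for i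
      proof -
        have "(j' + (i - j)) mod p \<in> I" using False jj that by blast
        then show ?thesis by (simp add: algebra_simps)
      qed
      ultimately have "card I = nat p"
        by (rule mod_shift_invariant_full[OF p less.prems(1,3)])
      then show ?thesis using le by linarith
    next
      case False
      moreover obtain j where "j \<in> J" using less.prems by blast
      ultimately have "J = {j}" by blast
      then show ?thesis using le by simp
    qed
  qed
qed

lemma bounded_Ioo_real: "bounded {a<..<b::real}"
  by (rule bounded_subset[OF compact_imp_bounded[OF compact_Icc[of a b]]]) auto

lemma lmeasurable_open_Ioo: "open X \<Longrightarrow> X \<subseteq> {a<..<b::real} \<Longrightarrow> X \<in> lmeasurable"
  by (rule lmeasurable_open[OF bounded_subset[OF bounded_Ioo_real]])

lemma measure_open_pos:
  assumes "open X" "X \<subseteq> {a<..<b::real}" "X \<noteq> {}"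
  shows "measure lebesgue X > 0"
proof -
  obtain x where x: "x \<in> X" using assms by blast
  then obtain e where e: "e > 0" "cball x e \<subseteq> X" using assms(1) open_contains_cball[of X] by blast
  have "measure lebesgue {x - e..x + e} \<le> measure lebesgue X"
    using e(2) lmeasurable_open_Ioo[OF assms(1,2)]
    by (intro measure_mono_fmeasurable) (auto simp: cball_eq_atLeastAtMost)
  then show ?thesis using e(1) by simp
qed

text \<open>A compact subset of almost full measure has positive distance to the complement of \<open>X\<close>, so
  every cell of a fine enough grid that meets it lies inside \<open>X\<close>.\<close>
lemma open_inner_cells:
  fixes X :: "real set"
  assumes "open X" "X \<subseteq> {0<..<L}" "e > 0" "L > 0"
  obtains N :: nat where "\<And>p::nat. p \<ge> N \<Longrightarrow> p > 0 \<Longrightarrow>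
    measure lebesgue X - e \<le> L / p * card {i \<in> {0..<int p}. {real_of_int i * (L / p)..(real_of_int i + 1) * (L / p)} \<subseteq> X}"
proof -
  have Xm: "X \<in> lmeasurable" using lmeasurable_open_Ioo[OF assms(1,2)] .
  obtain K where K: "closed K" "K \<subseteq> X" "X - K \<in> lmeasurable" "emeasure lebesgue (X - K) < ennreal e"
    using sets_lebesgue_inner_closed[OF fmeasurableD[OF Xm] assms(3)] by blast
  have "compact K"
    using K(1,2) assms(2) by (meson bounded_Ioo_real bounded_subset compact_eq_bounded_closed)
  then obtain d where d: "d > 0" "(\<Union>x\<in>K. ball x d) \<subseteq> X"
    using compact_subset_open_imp_ball_epsilon_subset[OF _ assms(1) K(2)] by blast
  have Km: "K \<in> lmeasurable" using \<open>compact K\<close> lmeasurable_compact by blast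
  have mK: "measure lebesgue X - e \<le> measure lebesgue K"
  proof -
    have "measure lebesgue (X - K) < e"
      using K(3,4) assms(3) by (simp add: emeasure_eq_measure2 ennreal_less_iff)
    moreover have "measure lebesgue (K \<union> X) = measure lebesgue K + measure lebesgue (X - K)"
      using Km Xm by (rule measure_Un2)
    moreover have "K \<union> X = X" using K by blast
    ultimately show ?thesis by simp
  qed
  show thesis
  proof
    fix p :: nat assume p: "p \<ge> nat \<lceil>L / d\<rceil> + 1" "p > 0"
    define h where "h = L / p"
    have h0: "h > 0" using assms p by (simp add: h_def)
    have "real p > L / d" using p(1) by linarith
    then have hd: "h < d" using p(2) d(1) by (simp add: h_def field_simps)
    define C where "C = {i \<in> {0..<int p}. {real_of_int i * h..(real_of_int i + 1) * h} \<subseteq> X}"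
    have finC: "finite C" unfolding C_def by (rule finite_subset[of _ "{0..<int p}"]) auto
    have "K \<subseteq> (\<Union>i\<in>C. {real_of_int i * h..(real_of_int i + 1) * h})"
    proof
      fix x assume x: "x \<in> K"
      define i where "i = \<lfloor>x / h\<rfloor>"
      have i: "i \<le> x / h" "x / h < i + 1" unfolding i_def by linarith+
      then have xi: "i * h \<le> x" "x < (real_of_int i + 1) * h" using h0 by (simp_all add: field_simps)
      have xL: "0 < x" "x < L" using x K assms by auto
      have "x / h < p" using xL p(2) assms(4) by (simp add: h_def field_simps)
      then have "i \<in> {0..<int p}" using xL h0 unfolding i_def by (auto simp: floor_less_iff)
      moreover have "{real_of_int i * h..(real_of_int i + 1) * h} \<subseteq> ball x d"
      proof
        fix y assume "y \<in> {real_of_int i * h..(real_of_int i + 1) * h}"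
        then have "\<bar>x - y\<bar> \<le> h" using xi by (auto simp: algebra_simps)
        then show "y \<in> ball x d" using hd by (simp add: dist_real_def)
      qed
      moreover have "ball x d \<subseteq> X" using d(2) x by blast
      ultimately have "i \<in> C" unfolding C_def by auto
      then show "x \<in> (\<Union>i\<in>C. {real_of_int i * h..(real_of_int i + 1) * h})" using xi by force
    qed
    then have "measure lebesgue K \<le> measure lebesgue (\<Union>i\<in>C. {real_of_int i * h..(real_of_int i + 1) * h})"
      using Km finC by (intro measure_mono_fmeasurable fmeasurable.finite_UN) auto
    also have "\<dots> \<le> (\<Sum>i\<in>C. measure lebesgue {real_of_int i * h..(real_of_int i + 1) * h})"
      using finC by (intro measure_UNION_le) auto
    also have "\<dots> = (\<Sum>i\<in>C. h)" using h0 by (intro sum.cong) (auto simp: algebra_simps)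
    also have "\<dots> = h * card C" by simp
    finally show "measure lebesgue X - e \<le> L / p * card {i \<in> {0..<int p}. {real_of_int i * (L / p)..(real_of_int i + 1) * (L / p)} \<subseteq> X}"
      using mK unfolding C_def h_def by linarith
  qed
qed

text \<open>The sumset in the circle of length \<open>L\<close>, with residues represented in \<open>(0, L)\<close>.\<close>
definition circle_sumset :: "real \<Rightarrow> real set \<Rightarrow> real set \<Rightarrow> real set" where
  "circle_sumset L X Y = {z \<in> {0<..<L}. \<exists>x\<in>X. \<exists>y\<in>Y. z = x + y \<or> z + L = x + y}"

lemma open_circle_sumset:
  assumes "open X" shows "open (circle_sumset L X Y)"
proof -
  define T where "T = (\<Union>x\<in>X. \<Union>y\<in>Y. {x + y})"
  have "open T" unfolding T_def using assms by (intro open_sums) simp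
  moreover have "circle_sumset L X Y = {0<..<L} \<inter> (T \<union> (\<lambda>z. z - L) ` T)"
  proof (intro set_eqI iffI)
    fix z assume "z \<in> circle_sumset L X Y"
    then obtain x y where *: "0 < z" "z < L" "x \<in> X" "y \<in> Y" "z = x + y \<or> z + L = x + y"
      unfolding circle_sumset_def by auto
    then have "x + y \<in> T" unfolding T_def by blast
    then have "z \<in> T \<or> z + L \<in> T" using * by auto
    moreover have "z = (z + L) - L" by simp
    ultimately show "z \<in> {0<..<L} \<inter> (T \<union> (\<lambda>z. z - L) ` T)" using * by (auto intro: rev_image_eqI)
  next
    fix z assume "z \<in> {0<..<L} \<inter> (T \<union> (\<lambda>z. z - L) ` T)"
    then have "z \<in> {0<..<L}" "z \<in> T \<or> z + L \<in> T" by auto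
    then show "z \<in> circle_sumset L X Y" unfolding circle_sumset_def T_def by auto
  qed
  ultimately show ?thesis by (auto intro!: open_Int open_Un open_translation_subtract)
qed

text \<open>Raikov's inequality. For a large prime \<open>q\<close>, the cells of length \<open>L / q\<close> inside \<open>X\<close> and inside
  \<open>Y\<close> correspond to sets of residues modulo \<open>q\<close>; the sum of the cells with indices \<open>i\<close> and \<open>j\<close>
  covers the cell with index \<open>i + j\<close>, and Cauchy--Davenport counts these.\<close>
lemma Raikov:
  assumes X: "open X" "X \<subseteq> {0<..<L}" "X \<noteq> {}" and Y: "open Y" "Y \<subseteq> {0<..<L}" "Y \<noteq> {}"
  shows "min L (measure lebesgue X + measure lebesgue Y) \<le> measure lebesgue (circle_sumset L X Y)"
proof (rule field_le_epsilon)
  fix e :: real assume e: "e > 0"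
  have L: "L > 0" using X by auto
  have "measure lebesgue X > 0" "measure lebesgue Y > 0"
    using measure_open_pos[OF X] measure_open_pos[OF Y] by simp_all
  \<comment> \<open>The loss also stays below half of each measure, so that both sets of cells are nonempty.\<close>
  then have m: "min (e / 3) (min (measure lebesgue X) (measure lebesgue Y) / 2) > 0" (is "?m > 0")
    using e by simp
  obtain N1 where N1: "\<And>p::nat. p \<ge> N1 \<Longrightarrow> p > 0 \<Longrightarrow>
    measure lebesgue X - ?m \<le> L / p * card {i \<in> {0..<int p}. {real_of_int i * (L / p)..(real_of_int i + 1) * (L / p)} \<subseteq> X}"
    using open_inner_cells[OF X(1,2) m L] by blast
  obtain N2 where N2: "\<And>p::nat. p \<ge> N2 \<Longrightarrow> p > 0 \<Longrightarrow>
    measure lebesgue Y - ?m \<le> L / p * card {i \<in> {0..<int p}. {real_of_int i * (L / p)..(real_of_int i + 1) * (L / p)} \<subseteq> Y}"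
    using open_inner_cells[OF Y(1,2) m L] by blast
  obtain q where q: "prime q" "q > N1 + N2 + nat \<lceil>3 * L / e\<rceil>"
    using bigger_prime by blast
  have q0: "q > 0" using q by simp
  define h where "h = L / q"
  have h0: "h > 0" using L q0 by (simp add: h_def)
  have "real q \<ge> 3 * L / e" using q(2) by linarith
  then have he: "h \<le> e / 3" using e q0 by (simp add: h_def field_simps)
  define I where "I = {i \<in> {0..<int q}. {real_of_int i * h..(real_of_int i + 1) * h} \<subseteq> X}"
  define J where "J = {i \<in> {0..<int q}. {real_of_int i * h..(real_of_int i + 1) * h} \<subseteq> Y}"
  have cI: "measure lebesgue X - ?m \<le> h * card I" using N1[of q] q q0 unfolding I_def h_def by simp
  have cJ: "measure lebesgue Y - ?m \<le> h * card J" using N2[of q] q q0 unfolding J_def h_def by simp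
  have "measure lebesgue X - ?m > 0" "measure lebesgue Y - ?m > 0"
    using m by (auto simp: min_def split: if_splits)
  then have ne: "I \<noteq> {}" "J \<noteq> {}" using cI cJ by (auto dest: less_le_trans)
  have fin: "finite I" "finite J"
    unfolding I_def J_def by (rule finite_subset[of _ "{0..<int q}"]; auto)+
  define C where "C = mod_sumset (int q) I J"
  have CD: "min q (card I + card J - 1) \<le> card C"
  proof -
    have "I \<subseteq> {0..<int q}" "J \<subseteq> {0..<int q}" unfolding I_def J_def by blast+
    then show ?thesis
      using Cauchy_Davenport[of "int q" I J] q(1) ne unfolding C_def by simp
  qed
  have finC: "finite C" "C \<subseteq> {0..<int q}"
    using mod_sumset_subset[of "int q" I J] q0 finite_subset[OF _ finite_atLeastLessThan_int]
    unfolding C_def by auto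
  have cell: "{real_of_int c * h<..<(real_of_int c + 1) * h} \<subseteq> circle_sumset L X Y" if cC: "c \<in> C" for c
  proof
    fix z assume z: "z \<in> {real_of_int c * h<..<(real_of_int c + 1) * h}"
    obtain i j where ij: "i \<in> I" "j \<in> J" "c = (i + j) mod int q"
      using cC unfolding C_def mod_sumset_def by blast
    have c: "0 \<le> c" "c + 1 \<le> int q" using cC finC by auto
    have qh: "q * h = L" using q0 by (simp add: h_def)
    have "0 \<le> c * h" using c h0 by simp
    have "real_of_int c + 1 \<le> q" using c(2) by linarith
    then have "(real_of_int c + 1) * h \<le> L" using mult_right_mono[of "real_of_int c + 1" q h] h0 qh by simp
    then have zL: "z \<in> {0<..<L}" using z \<open>0 \<le> c * h\<close> by auto
    have "i + j = c \<or> i + j = c + int q"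
    proof -
      have "i + j < 2 * int q" "0 \<le> i + j" using ij unfolding I_def J_def by auto
      moreover have "i + j = c + int q" if "int q \<le> i + j" "i + j < 2 * int q"
        using that ij(3) mod_pos_pos_trivial[of "i + j - int q" "int q"] by simp
      ultimately show ?thesis using ij(3) mod_pos_pos_trivial[of "i + j" "int q"] by linarith
    qed
    moreover
    define t where "t = (z - c * h) / 2"
    have t: "0 \<le> t" "t \<le> h" using z h0 unfolding t_def by (auto simp: algebra_simps)
    have "i * h + t \<in> X" using ij t unfolding I_def by (auto simp: algebra_simps)
    moreover have "j * h + t \<in> Y" using ij t unfolding J_def by (auto simp: algebra_simps)
    moreover have "i + j = c \<Longrightarrow> z = (i * h + t) + (j * h + t)"
      unfolding t_def by (auto simp: algebra_simps)
    moreover have "i + j = c + int q \<Longrightarrow> z + L = (i * h + t) + (j * h + t)"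
    proof -
      assume "i + j = c + int q"
      then have "real_of_int i + j = c + q" by linarith
      then have "(i + j) * h = c * h + L" using qh by (simp add: algebra_simps)
      then show ?thesis unfolding t_def by (simp add: algebra_simps)
    qed
    ultimately show "z \<in> circle_sumset L X Y" using zL unfolding circle_sumset_def by blast
  qed
  have "h * card C = (\<Sum>c\<in>C. h)" by simp
  also have "\<dots> = (\<Sum>c\<in>C. measure lebesgue {real_of_int c * h<..<(real_of_int c + 1) * h})"
    using h0 by (intro sum.cong) (auto simp: algebra_simps)
  also have "\<dots> = measure lebesgue (\<Union>c\<in>C. {real_of_int c * h<..<(real_of_int c + 1) * h})"
  proof (rule measure_UNION'[symmetric, OF finC(1)])
    show "pairwise (\<lambda>i j. disjnt {real_of_int i * h<..<(real_of_int i + 1) * h} {real_of_int j * h<..<(real_of_int j + 1) * h}) C"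
    proof (clarsimp simp: pairwise_def disjnt_iff)
      fix i j :: int and x assume ij: "i \<noteq> j" and *: "i * h < x" "x < (real_of_int i + 1) * h" "j * h < x" "x < (real_of_int j + 1) * h"
      then have "i * h < (real_of_int j + 1) * h" "j * h < (real_of_int i + 1) * h" by linarith+
      then have "real_of_int i < j + 1" "real_of_int j < i + 1" using h0 by simp_all
      then show False using ij by linarith
    qed
  qed auto
  also have "\<dots> \<le> measure lebesgue (circle_sumset L X Y)"
  proof (rule measure_mono_fmeasurable)
    show "circle_sumset L X Y \<in> lmeasurable"
      using open_circle_sumset[OF X(1)] by (intro lmeasurable_open_Ioo[of _ 0 L]) (auto simp: circle_sumset_def)
  qed (use cell in auto)
  finally have main: "h * card C \<le> measure lebesgue (circle_sumset L X Y)" .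
  have "card I > 0" using ne fin by (simp add: card_gt_0_iff)
  then have "min (real q) (real (card I) + card J - 1) \<le> card C" using CD by linarith
  then have "h * min (real q) (real (card I) + card J - 1) \<le> h * card C"
    using h0 by (intro mult_left_mono) auto
  moreover have "h * min (real q) (real (card I) + card J - 1) = min L (h * card I + h * card J - h)"
    using h0 q0 by (simp add: min_mult_distrib_left h_def algebra_simps)
  moreover have "?m \<le> e / 3" by simp
  ultimately show "min L (measure lebesgue X + measure lebesgue Y) \<le> measure lebesgue (circle_sumset L X Y) + e"
    using main cI cJ he e by linarith
qed

section \<open>Open semigroups of positive reals and their windows\<close>

lemma measure_reflect:
  fixes X :: "real set"
  shows "measure lebesgue ((\<lambda>x. a - x) ` X) = measure lebesgue X"
  using measure_lebesgue_affine[of "-1" a X] by (simp cong: image_cong_simp)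

lemma open_reflect:
  fixes X :: "real set"
  assumes "open X" shows "open {x. a - x \<in> X}"
  using open_vimage[OF assms, of "\<lambda>x. a - x"] by (simp add: vimage_def continuous_intros)

locale open_semigroup =
  fixes S :: "real set"
  assumes open_S: "open S"
    and pos: "s \<in> S \<Longrightarrow> s > 0"
    and add: "s \<in> S \<Longrightarrow> t \<in> S \<Longrightarrow> s + t \<in> S"
begin

text \<open>Periods are more than the elements of \<open>S\<close>: by openness their positive limits are periods
  too, for example the supremum and the infimum of \<open>S \<inter> (0, 1)\<close>.\<close>
definition is_period :: "real \<Rightarrow> bool" where
  "is_period y \<longleftrightarrow> y > 0 \<and> (\<forall>s\<in>S. s + y \<in> S)"

text \<open>Reflected copy of \<open>S \<inter> (z - y, z)\<close>: measuring downwards from \<open>z\<close> makes windows add up, since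
  \<open>(a - s) + (b - t) = (a + b) - (s + t)\<close>.\<close>
definition window :: "real \<Rightarrow> real \<Rightarrow> real set" where
  "window y z = {\<theta> \<in> {0<..<y}. z - \<theta> \<in> S}"

abbreviation W :: "real \<Rightarrow> real \<Rightarrow> real" where
  "W y z \<equiv> measure lebesgue (window y z)"

lemma is_period_mem: "y \<in> S \<Longrightarrow> is_period y"
  using pos add by (simp add: is_period_def)

lemma open_window: "open (window y z)"
proof -
  have "window y z = {0<..<y} \<inter> {x. z - x \<in> S}" by (auto simp: window_def)
  then show ?thesis using open_reflect[OF open_S] by (simp add: open_Int)
qed

lemma window_subset: "window y z \<subseteq> {0<..<y}"
  by (auto simp: window_def)

lemma lmeasurable_window: "window y z \<in> lmeasurable"
  by (rule lmeasurable_open_Ioo[OF open_window window_subset])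

lemma lmeasurable_S_Ioo: "S \<inter> {a<..<b} \<in> lmeasurable"
  by (rule lmeasurable_open_Ioo[of _ a b]) (auto simp: open_S open_Int)

lemma W_eq: "W y z = measure lebesgue (S \<inter> {z - y<..<z})"
proof -
  have "(\<lambda>x. z - x) ` (S \<inter> {z - y<..<z}) = window y z"
  proof (intro equalityI subsetI)
    fix t assume "t \<in> window y z"
    then have "z - t \<in> S \<inter> {z - y<..<z}" by (auto simp: window_def)
    moreover have "t = z - (z - t)" by simp
    ultimately show "t \<in> (\<lambda>x. z - x) ` (S \<inter> {z - y<..<z})" by blast
  qed (auto simp: window_def)
  then show ?thesis using measure_reflect[of z "S \<inter> {z - y<..<z}"] by simp
qed

lemma W_le: assumes "0 \<le> y" shows "W y z \<le> y"
proof -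
  have "W y z \<le> measure lebesgue {0<..<y}"
    using window_subset lmeasurable_window fmeasurableD
    by (intro measure_mono_fmeasurable) auto
  then show ?thesis using assms by simp
qed

lemma window_nonempty_iff: "window y z \<noteq> {} \<longleftrightarrow> W y z > 0"
proof -
  have "window y z \<noteq> {} \<Longrightarrow> W y z > 0"
    by (rule measure_open_pos[OF open_window window_subset])
  then show ?thesis by auto
qed

lemma measure_S_split:
  assumes "a \<le> b" "b \<le> c"
  shows "measure lebesgue (S \<inter> {a<..<c}) = measure lebesgue (S \<inter> {a<..<b}) + measure lebesgue (S \<inter> {b<..<c})"
proof -
  have "measure lebesgue (S \<inter> {a<..<c}) = measure lebesgue ((S \<inter> {a<..<b}) \<union> (S \<inter> {b<..<c}))"
  proof (rule measure_eq_AE)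
    have "AE x in lebesgue. x \<noteq> b"
      by (rule AE_completion) (rule AE_lborel_singleton)
    then show "AE x in lebesgue. (x \<in> S \<inter> {a<..<c}) = (x \<in> (S \<inter> {a<..<b}) \<union> (S \<inter> {b<..<c}))"
      by (rule AE_mp) (use assms in auto)
  qed (use lmeasurable_S_Ioo fmeasurableD in blast)+
  also have "\<dots> = measure lebesgue (S \<inter> {a<..<b}) + measure lebesgue (S \<inter> {b<..<c})"
    using lmeasurable_S_Ioo by (subst measure_Un3) (auto simp: disjoint_iff Int_Un_distrib intro!: arg_cong[of _ "{}" "measure lebesgue", simplified])
  finally show ?thesis .
qed

lemma measure_S_shift_mono:
  assumes "is_period y"
  shows "measure lebesgue (S \<inter> {a<..<b}) \<le> measure lebesgue (S \<inter> {a + y<..<b + y})"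
proof -
  have "(\<lambda>x. y + x) ` (S \<inter> {a<..<b}) \<subseteq> S \<inter> {a + y<..<b + y}"
    using assms by (auto simp: is_period_def add.commute)
  then have "measure lebesgue ((\<lambda>x. y + x) ` (S \<inter> {a<..<b})) \<le> measure lebesgue (S \<inter> {a + y<..<b + y})"
    by (rule measure_mono_fmeasurable)
      (rule fmeasurableD[OF measurable_translation[OF lmeasurable_S_Ioo]], rule lmeasurable_S_Ioo)
  then show ?thesis by (simp add: measure_translation)
qed

text \<open>The part of \<open>S\<close> that leaves at the lower end of the window re-enters, shifted by \<open>y\<close>, at the
  upper end.\<close>
lemma W_mono_step:
  assumes "is_period y" "0 \<le> r" "r \<le> y"
  shows "W y z \<le> W y (z + r)"
proof -
  have "W y z = measure lebesgue (S \<inter> {z - y<..<z - y + r}) + measure lebesgue (S \<inter> {z - y + r<..<z})"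
    unfolding W_eq using assms by (intro measure_S_split) auto
  also have "\<dots> \<le> measure lebesgue (S \<inter> {z<..<z + r}) + measure lebesgue (S \<inter> {z - y + r<..<z})"
    using measure_S_shift_mono[OF assms(1), of "z - y" "z - y + r"] by (simp add: algebra_simps)
  also have "\<dots> = W y (z + r)"
    unfolding W_eq using assms measure_S_split[of "z - y + r" z "z + r"] by (simp add: algebra_simps)
  finally show ?thesis .
qed

lemma W_mono:
  assumes "is_period y" "z \<le> z'"
  shows "W y z \<le> W y z'"
proof -
  have y: "y > 0" using assms by (simp add: is_period_def)
  have chain: "W y z \<le> W y (z + real n * y)" for n
  proof (induction n)
    case (Suc n)
    have "W y (z + real n * y) \<le> W y (z + real n * y + y)"
      using W_mono_step[OF assms(1), of y] y by simp
    with Suc show ?case by (simp add: algebra_simps)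
  qed simp
  define n where "n = nat \<lfloor>(z' - z) / y\<rfloor>"
  have "0 \<le> (z' - z) / y" using y assms by simp
  then have n: "real n \<le> (z' - z) / y" "(z' - z) / y < real n + 1"
    unfolding n_def by linarith+
  then have "real n * y \<le> z' - z" "z' - z < real n * y + y"
    using y by (simp_all add: field_simps)
  then have "W y (z + real n * y) \<le> W y (z + real n * y + (z' - z - real n * y))"
    by (intro W_mono_step[OF assms(1)]) auto
  then show ?thesis using chain[of n] by simp
qed

text \<open>The sum of points in the windows ending at \<open>a\<close> and \<open>b\<close> lies in the window ending at \<open>a + b\<close> or
  one period below it, and in the second case it can be lifted by \<open>y\<close>. So the sumset on the circle
  of length \<open>y\<close> embeds in the window, and Raikov's inequality applies.\<close>
lemma W_superadd:
  assumes y: "is_period y" and "0 \<le> a" "0 \<le> b"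
  shows "min y (W y a + W y b) \<le> W y (a + b)"
proof (cases "window y a = {} \<or> window y b = {}")
  case True
  then have "W y a = 0 \<or> W y b = 0" by auto
  then show ?thesis
    using W_mono[OF y, of a "a + b"] W_mono[OF y, of b "a + b"] assms by auto
next
  case False
  have "circle_sumset y (window y a) (window y b) \<subseteq> window y (a + b)"
  proof
    fix z assume "z \<in> circle_sumset y (window y a) (window y b)"
    then obtain s t where z: "z \<in> {0<..<y}" "s \<in> window y a" "t \<in> window y b" "z = s + t \<or> z + y = s + t"
      unfolding circle_sumset_def by blast
    then have *: "(a - s) + (b - t) \<in> S" by (auto simp: window_def intro: add)
    then have "(a - s) + (b - t) + y \<in> S" using y by (simp add: is_period_def)
    moreover have "a + b - z = (a - s) + (b - t) \<or> a + b - z = (a - s) + (b - t) + y"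
      using z(4) by argo
    ultimately have "a + b - z \<in> S" using * by metis
    then show "z \<in> window y (a + b)" using z by (simp add: window_def)
  qed
  then have "measure lebesgue (circle_sumset y (window y a) (window y b)) \<le> W y (a + b)"
    using lmeasurable_window open_circle_sumset[OF open_window]
    by (intro measure_mono_fmeasurable) (auto intro!: fmeasurableD lmeasurable_open_Ioo[of _ 0 y] simp: circle_sumset_def)
  moreover have "min y (W y a + W y b) \<le> measure lebesgue (circle_sumset y (window y a) (window y b))"
    using False by (intro Raikov open_window window_subset) auto
  ultimately show ?thesis by simp
qed

text \<open>Two sets of total measure more than \<open>y\<close> in the circle of length \<open>y\<close> represent every residue
  as a sum.\<close>
lemma mem_if_W_large:
  assumes y: "is_period y" and "W y a + W y b > y" and u: "a + b \<le> u"
  shows "u \<in> S"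
proof -
  define Y where "Y = (\<lambda>x. y - x) ` window y (u - a)"
  have Ym: "measure lebesgue Y = W y (u - a)" unfolding Y_def by (rule measure_reflect)
  have Y_eq: "Y = {0<..<y} \<inter> {x. y - x \<in> window y (u - a)}"
    unfolding Y_def using window_subset[of y "u - a"] by (force simp: image_iff)
  have YL: "Y \<in> lmeasurable"
    unfolding Y_eq by (intro lmeasurable_open_Ioo[of _ 0 y] open_Int open_reflect open_window) auto
  have "window y a \<inter> Y \<noteq> {}"
  proof
    assume "window y a \<inter> Y = {}"
    then have "measure lebesgue (window y a \<union> Y) = W y a + W y (u - a)"
      using YL lmeasurable_window by (simp add: measure_Un3 Ym)
    moreover have "measure lebesgue (window y a \<union> Y) \<le> measure lebesgue {0<..<y}"
      using YL lmeasurable_window window_subset Y_eq by (intro measure_mono_fmeasurable) auto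
    moreover have "W y b \<le> W y (u - a)" using W_mono[OF y] u by simp
    ultimately show False using assms y by (simp add: is_period_def)
  qed
  then obtain s where "s \<in> window y a" "y - s \<in> window y (u - a)" unfolding Y_eq by blast
  then have "(a - s) + (u - a - (y - s)) \<in> S" unfolding window_def using add by blast
  then have "(a - s) + (u - a - (y - s)) + y \<in> S" using y by (auto simp: is_period_def)
  then show ?thesis by simp
qed

lemma W_multiple:
  assumes "is_period y" "0 \<le> z"
  shows "min y (real n * W y z) \<le> W y (real n * z)"
proof (induction n)
  case (Suc n)
  have "min y (W y (real n * z) + W y z) \<le> W y (real (Suc n) * z)"
    using W_superadd[OF assms(1), of "real n * z" z] assms(2) by (simp add: algebra_simps)
  moreover have "real (Suc n) * W y z = real n * W y z + W y z" by (simp add: algebra_simps)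
  moreover have "0 \<le> W y z" by simp
  ultimately show ?case using Suc by linarith
qed (use assms in \<open>simp add: is_period_def\<close>)

lemma mem_if_multiple_W_large:
  assumes y: "is_period y" and z: "0 \<le> z" and big: "real n * W y z > y" and u: "real n * z \<le> u"
  shows "u \<in> S"
proof -
  have "y > 0" using y by (simp add: is_period_def)
  then have W0: "W y z > 0" using big by (metis measure_nonneg less_eq_real_def mult_zero_right not_less)
  obtain m where n: "n = Suc m" using big \<open>y > 0\<close> by (cases n) auto
  have "min y (real m * W y z) \<le> W y (real m * z)" using W_multiple[OF y z] .
  then have "W y (real m * z) + W y z > y"
    using big W0 unfolding n by (auto simp: algebra_simps min_def split: if_splits)
  then show ?thesis using mem_if_W_large[OF y] u unfolding n by (simp add: algebra_simps)
qed

end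

section \<open>The general bound for gaps\<close>

lemma measure_pigeonhole:
  assumes X: "X \<in> lmeasurable" "X \<subseteq> {l<..<r::real}" and Y: "Y \<in> lmeasurable" "Y \<subseteq> {l<..<r}"
    and "l \<le> r" and big: "measure lebesgue X + measure lebesgue Y > r - l"
  shows "X \<inter> Y \<noteq> {}"
proof
  assume "X \<inter> Y = {}"
  then have "measure lebesgue (X \<union> Y) = measure lebesgue X + measure lebesgue Y"
    using X Y by (simp add: measure_Un3)
  moreover have "measure lebesgue (X \<union> Y) \<le> measure lebesgue {l<..<r}"
    using X Y by (intro measure_mono_fmeasurable) auto
  ultimately show False using big assms(5) by simp
qed

context open_semigroup
begin

lemma is_period_closure:
  assumes "t > 0" "t \<in> closure S"
  shows "is_period t"
  unfolding is_period_def
proof (intro conjI ballI)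
  fix s assume "s \<in> S"
  then obtain e where e: "e > 0" "ball s e \<subseteq> S" using open_S open_contains_ball[of S] by blast
  obtain a where a: "a \<in> S" "dist a t < e" using assms(2) e(1) closure_approachable[of t S] by blast
  have "s + t - a \<in> ball s e" using a(2) by (simp add: dist_real_def abs_minus_commute)
  then have "(s + t - a) + a \<in> S" using e a add by blast
  then show "s + t \<in> S" by simp
qed (use assms in auto)

lemma measure_S_Ioo_le: "a \<le> b \<Longrightarrow> measure lebesgue (S \<inter> {a<..<b}) \<le> b - a"
  using W_le[of "b - a" b] by (simp add: W_eq)

text \<open>The reflection \<open>s \<mapsto> a + b - s\<close> of the interval onto itself cannot carry \<open>S\<close> off itself.\<close>
lemma exists_complementary:
  assumes "a \<le> b" "measure lebesgue (S \<inter> {a<..<b}) > (b - a) / 2"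
  shows "\<exists>s. a < s \<and> s < b \<and> s \<in> S \<and> a + b - s \<in> S"
proof -
  let ?X = "S \<inter> {a<..<b}" and ?Y = "(\<lambda>x. a + b - x) ` (S \<inter> {a<..<b})"
  have Y: "?Y = {a<..<b} \<inter> {x. a + b - x \<in> S \<inter> {a<..<b}}"
    by (force simp: image_iff)
  have "?Y \<in> lmeasurable"
    unfolding Y by (intro lmeasurable_open_Ioo[of _ a b] open_Int open_reflect open_S) auto
  then have "?X \<inter> ?Y \<noteq> {}"
    using assms measure_reflect[of "a + b" ?X] lmeasurable_S_Ioo
    by (intro measure_pigeonhole[of _ a b]) (auto simp: Y)
  then show ?thesis by auto
qed

text \<open>Not both \<open>s\<close> and \<open>u - s\<close> can belong to \<open>S\<close>.\<close>
lemma measure_S_below_gap: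
  assumes "u \<notin> S" "0 \<le> u"
  shows "measure lebesgue (S \<inter> {0<..<u}) \<le> u / 2"
proof (rule ccontr)
  assume "\<not> ?thesis"
  then obtain s where "s \<in> S" "0 + u - s \<in> S"
    using exists_complementary[of 0 u] assms by auto
  then have "s + (0 + u - s) \<in> S" by (rule add)
  then show False using assms by simp
qed

lemma W_unit_ge:
  assumes "is_period 1" "\<alpha> \<le> W 1 1" "0 \<le> \<alpha>"
  shows "min 1 (real j * \<alpha>) \<le> W 1 (real j)"
proof -
  have "min 1 (real j * \<alpha>) \<le> min 1 (real j * W 1 1)"
    using assms by (intro min.mono mult_left_mono) auto
  also have "\<dots> \<le> W 1 (real j)" using W_multiple[OF assms(1), of 1 j] by simp
  finally show ?thesis .
qed

lemma measure_S_initial: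
  assumes "is_period 1" "\<alpha> \<le> W 1 1" "0 \<le> \<alpha>" "real k * \<alpha> \<le> 1"
  shows "real k * (real k + 1) / 2 * \<alpha> \<le> measure lebesgue (S \<inter> {0<..<real k})"
  using assms(4)
proof (induction k)
  case (Suc k)
  have "real k * \<alpha> \<le> real (Suc k) * \<alpha>" using assms(3) by (intro mult_right_mono) auto
  then have "real k * (real k + 1) / 2 * \<alpha> \<le> measure lebesgue (S \<inter> {0<..<real k})"
    using Suc by linarith
  moreover have "real (Suc k) * \<alpha> \<le> W 1 (real (Suc k))"
    using W_unit_ge[OF assms(1-3), of "Suc k"] Suc.prems by (simp add: min_def)
  moreover have "measure lebesgue (S \<inter> {0<..<real (Suc k)})
      = measure lebesgue (S \<inter> {0<..<real k}) + W 1 (real (Suc k))"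
    using measure_S_split[of 0 "real k" "real (Suc k)"] by (simp add: W_eq)
  ultimately show ?case by (simp add: field_simps)
qed simp

text \<open>The lower bound \<open>\<alpha> + 2 \<alpha> + \<dots> + k \<alpha>\<close> for the measure of \<open>S \<inter> (0, k)\<close> is compared with the upper
  bound \<open>u / 2\<close> on \<open>(0, u)\<close> and the length of \<open>(u, k)\<close>. If \<open>u\<close> lies beyond \<open>k\<close>, almost all of \<open>(k, u)\<close>
  belongs to \<open>S\<close>, and the same inequality results.\<close>
lemma gap_bound:
  assumes per: "is_period 1" and \<alpha>: "\<alpha> \<le> W 1 1" "0 \<le> \<alpha>"
    and k: "k \<ge> 1" "real k * \<alpha> \<le> 1" "1 < (real k + 1) * \<alpha>" and u: "u \<notin> S"
  shows "u \<le> real k * (2 - (real k + 1) * \<alpha>)"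
proof (cases "u \<ge> 0")
  case False
  have "\<alpha> \<le> real k * \<alpha>" using k \<alpha> by (simp add: mult_le_cancel_right1)
  moreover have "(real k + 1) * \<alpha> = real k * \<alpha> + \<alpha>" by (simp add: algebra_simps)
  ultimately have "0 \<le> 2 - (real k + 1) * \<alpha>" using k by linarith
  then have "0 \<le> real k * (2 - (real k + 1) * \<alpha>)" by simp
  then show ?thesis using False by linarith
next
  case u0: True
  let ?\<mu> = "\<lambda>a b. measure lebesgue (S \<inter> {a<..<b})"
  have low: "real k * (real k + 1) / 2 * \<alpha> \<le> ?\<mu> 0 (real k)"
    by (rule measure_S_initial[OF per \<alpha> k(2)])
  have half: "?\<mu> 0 u \<le> u / 2" using measure_S_below_gap[OF u u0] .
  have "real k * (real k + 1) / 2 * \<alpha> \<le> real k - u / 2"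
  proof (cases "u \<le> real k")
    case True
    then have "?\<mu> 0 (real k) = ?\<mu> 0 u + ?\<mu> u (real k)" using u0 by (intro measure_S_split)
    moreover have "?\<mu> u (real k) \<le> real k - u" using True by (rule measure_S_Ioo_le)
    ultimately show ?thesis using low half by linarith
  next
    case False
    have Wk: "W 1 (real k) \<ge> real k * \<alpha>" using W_unit_ge[OF per \<alpha>, of k] k by simp
    have uk: "u < real k + 1"
    proof (rule ccontr)
      assume "\<not> ?thesis"
      moreover have "W 1 (real k) + W 1 1 > 1" using Wk \<alpha> k(3) by (simp add: algebra_simps)
      ultimately show False using mem_if_W_large[OF per, of "real k" 1 u] u by simp
    qed
    have "min 1 ((real k + 1) * \<alpha>) \<le> W 1 (real k + 1)"
      using W_unit_ge[OF per \<alpha>, of "Suc k"] by (simp add: add.commute)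
    then have "1 \<le> ?\<mu> (real k) (real k + 1)" using k(3) by (simp add: W_eq)
    moreover have "?\<mu> (real k) (real k + 1) = ?\<mu> (real k) u + ?\<mu> u (real k + 1)"
      using False uk by (intro measure_S_split) auto
    moreover have "?\<mu> u (real k + 1) \<le> real k + 1 - u" using uk by (intro measure_S_Ioo_le) auto
    moreover have "?\<mu> 0 u = ?\<mu> 0 (real k) + ?\<mu> (real k) u"
      using False by (intro measure_S_split) auto
    ultimately show ?thesis using low half by linarith
  qed
  then show ?thesis by (simp add: field_simps)
qed

lemma W_le_of_gap:
  assumes y: "is_period y" and z: "0 \<le> z" and m: "m \<ge> 1" "real m * z \<le> u" and u: "u \<notin> S"
  shows "W y z \<le> y / real m"
proof (rule ccontr)
  assume "\<not> ?thesis"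
  then have "real m * W y z > y" using m by (simp add: field_simps)
  then show False using mem_if_multiple_W_large[OF y z _ m(2)] u by blast
qed

lemma measure_S_windows:
  "0 \<le> y \<Longrightarrow> measure lebesgue (S \<inter> {a - real m * y<..<a}) = (\<Sum>i<m. W y (a - real i * y))"
proof (induction m)
  case (Suc m)
  then show ?case
    using measure_S_split[of "a - real (Suc m) * y" "a - real m * y" a]
    by (simp add: W_eq algebra_simps)
qed simp

text \<open>With \<open>y\<close> as the period, \<open>W y z\<close> is at most about \<open>y z / K\<close>, because \<open>\<lfloor>K / z\<rfloor>\<close> copies of the
  window ending at \<open>z\<close> do not fill a period below the gap \<open>u\<close>. Adding the windows ending at
  \<open>1, 1 - y, 1 - 2 y, \<dots>\<close>, which cover \<open>(0, 1)\<close>, gives essentially a Riemann sum for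
  \<open>\<integral> z / K = 1 / (2 K)\<close>, about half of what the unit period would permit.\<close>
lemma small_element_density:
  assumes y: "y \<in> S" "y \<le> 1/2" and K: "K \<ge> 2" "real K \<le> u" and u: "u \<notin> S"
  shows "W 1 1 \<le> y / real K + (1 - y / 2)\<^sup>2 / (2 * (real K - 1))"
proof -
  have y0: "y > 0" using y pos by blast
  have per: "is_period y" using y is_period_mem by blast
  have Wz: "W y z \<le> y * z / (real K - 1)" if "0 \<le> z" "z \<le> 1" for z
  proof (cases "z = 0")
    case True
    have "S \<inter> {0 - y<..<0} = {}" using pos by force
    then show ?thesis using True by (simp add: W_eq)
  next
    case False
    then have z: "z > 0" using that by simp
    define m where "m = nat \<lfloor>real K / z\<rfloor>"
    have "real K / z \<ge> real K" 
      using z that mult_right_mono[of z 1 "real K"] by (simp add: field_simps)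
    then have m: "real m \<le> real K / z" "real K / z < real m + 1" "m \<ge> 1"
      using K unfolding m_def by (linarith, linarith, linarith)
    have mz: "real m * z \<le> real K" "real K - z < real m * z" using m z by (simp_all add: field_simps)
    then have "W y z \<le> y / real m"
      using m K u z by (intro W_le_of_gap[OF per, of z m u]) auto
    also have "\<dots> = y * z / (real m * z)" using z by simp
    also have "\<dots> \<le> y * z / (real K - 1)"
      using mz that K y0 z by (intro divide_left_mono) auto
    finally show ?thesis .
  qed
  define n where "n = nat \<lfloor>1 / y\<rfloor>"
  have "1 / y > 0" using y0 by simp
  then have n: "real n \<le> 1 / y" "1 / y < real n + 1" unfolding n_def by linarith+
  then have ny: "real n * y \<le> 1" "1 < (real n + 1) * y" using y0 by (simp_all add: field_simps)
  have "W 1 1 = measure lebesgue (S \<inter> {0<..<1})" by (simp add: W_eq)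
  also have "\<dots> \<le> measure lebesgue (S \<inter> {1 - real (Suc n) * y<..<1})"
    using ny by (intro measure_mono_fmeasurable) (auto intro: lmeasurable_S_Ioo fmeasurableD simp: algebra_simps)
  also have "\<dots> = (\<Sum>i<Suc n. W y (1 - real i * y))"
    using y0 by (intro measure_S_windows) auto
  also have "\<dots> = W y 1 + (\<Sum>i<n. W y (1 - real (Suc i) * y))"
    by (subst sum.lessThan_Suc_shift) simp
  also have "\<dots> \<le> y / real K + (\<Sum>i<n. y * (1 - real (Suc i) * y) / (real K - 1))"
  proof (intro add_mono sum_mono)
    show "W y 1 \<le> y / real K" using K u by (intro W_le_of_gap[OF per]) auto
  next
    fix i assume "i \<in> {..<n}"
    then have "real (Suc i) * y \<le> real n * y" using y0 by (intro mult_right_mono) auto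
    then have "real (Suc i) * y \<le> 1" using ny(1) by linarith
    then show "W y (1 - real (Suc i) * y) \<le> y * (1 - real (Suc i) * y) / (real K - 1)"
      using ny(1) y0 by (intro Wz) (auto simp del: of_nat_Suc)
  qed
  also have "(\<Sum>i<n. y * (1 - real (Suc i) * y) / (real K - 1))
      = (real n * y - (real n * y)\<^sup>2 / 2 - real n * y * y / 2) / (real K - 1)"
  proof -
    have "(\<Sum>i<n. y * (1 - real (Suc i) * y)) = real n * y - (real n * y)\<^sup>2 / 2 - real n * y * y / 2"
      by (induction n) (simp_all add: power2_eq_square field_simps)
    then show ?thesis by (simp add: sum_divide_distrib[symmetric])
  qed
  also have "\<dots> \<le> ((1 - y / 2)\<^sup>2 / 2) / (real K - 1)"
  proof (rule divide_right_mono)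
    \<comment> \<open>The left-hand side is a quadratic polynomial in \<open>n y\<close> with its maximum at \<open>1 - y / 2\<close>.\<close>
    have "0 \<le> (real n * y - (1 - y / 2))\<^sup>2 / 2" by simp
    then show "real n * y - (real n * y)\<^sup>2 / 2 - real n * y * y / 2 \<le> (1 - y / 2)\<^sup>2 / 2"
      by (simp add: power2_eq_square field_simps)
  qed (use K in simp)
  finally show ?thesis by simp
qed

end

text \<open>The left-hand side is below its chord over \<open>[0, 1/2]\<close> and largest at \<open>y = 1/2\<close>. For \<open>K = 9\<close> it is
  then \<open>0.0907...\<close>, just below \<open>1 / 11\<close>; this is where ten enters as the threshold for \<open>1 / \<alpha>\<close>.\<close>
lemma small_element_estimate:
  fixes y K :: real
  assumes "0 \<le> y" "y \<le> 1/2" "K \<ge> 9"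
  shows "y / K + (1 - y / 2)\<^sup>2 / (2 * (K - 1)) < 1 / (K + 2)"
proof -
  have "y * y \<le> y * (1/2)" using assms by (intro mult_left_mono) auto
  then have "(1 - y / 2)\<^sup>2 \<le> 1 - 7 * y / 8" by (simp add: power2_eq_square field_simps)
  then have "y / K + (1 - y / 2)\<^sup>2 / (2 * (K - 1)) \<le> y / K + (1 - 7 * y / 8) / (2 * (K - 1))"
    using assms by (intro add_left_mono divide_right_mono) auto
  also have "(1 - 7 * y / 8) / (2 * (K - 1)) = 1 / (2 * (K - 1)) - y * (7 / (16 * (K - 1)))"
    using assms by (simp add: diff_divide_distrib)
  also have "y / K + (1 / (2 * (K - 1)) - y * (7 / (16 * (K - 1))))
      = 1 / (2 * (K - 1)) + y * (1 / K - 7 / (16 * (K - 1)))"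
    by (simp add: right_diff_distrib)
  also have "\<dots> \<le> 1 / (2 * (K - 1)) + 1/2 * (1 / K - 7 / (16 * (K - 1)))"
    using assms by (intro add_left_mono mult_right_mono) (auto simp: field_simps)
  also have "\<dots> = (25 * K - 16) / (32 * K * (K - 1))"
  proof -
    define D where "D = K - 1"
    have "D > 0" using assms by (simp add: D_def)
    then have "1 / (2 * D) + 1/2 * (1 / K - 7 / (16 * D)) = (9 * K + 16 * D) / (32 * K * D)"
      using assms by (simp add: field_simps)
    then show ?thesis by (simp add: D_def)
  qed
  also have "\<dots> < 1 / (K + 2)"
  proof -
    have "0 < 7 * (K * (K - 9)) - 3 * (K - 9) + 5"
      using assms mult_right_mono[of 9 K "K - 9"] by (auto simp: algebra_simps)
    then have "(25 * K - 16) * (K + 2) < 32 * K * (K - 1)" by (simp add: algebra_simps)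
    then show ?thesis using assms by (simp add: divide_simps mult.commute)
  qed
  finally show ?thesis .
qed

section \<open>The sharp bound for small measure\<close>

context open_semigroup
begin

text \<open>Freiman's lower bound for \<open>X + X\<close>, where \<open>X = 1 - S \<inter> (c, 1)\<close>. Two consecutive
  periods of length \<open>1 - c \<le> 1/2\<close> fit into \<open>(1, 2)\<close>. The residues of \<open>X + X\<close> occur in at least one of
  them, and those of \<open>X\<close> in both, since both 1 and \<open>c\<close> can be added to \<open>S \<inter> (c, 1)\<close>.\<close>
lemma W_two_ge:
  assumes per: "is_period 1" "is_period c" and c: "1/2 \<le> c" "c < 1"
    and low: "\<And>s. s \<in> S \<Longrightarrow> c < s" and ne: "W 1 1 > 0"
  shows "W 1 1 + min (1 - c) (2 * W 1 1) \<le> W 1 2"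
proof -
  define \<beta> where "\<beta> = 1 - c"
  have \<beta>: "0 < \<beta>" "\<beta> \<le> 1/2" using c by (auto simp: \<beta>_def)
  define X where "X = window 1 1"
  have X: "open X" "X \<subseteq> {0<..<\<beta>}" "X \<noteq> {}"
    using open_window low window_nonempty_iff[of 1 1] ne unfolding X_def \<beta>_def
    by (auto simp: window_def dest: low)
  have XL: "X \<in> lmeasurable" by (simp add: X_def lmeasurable_window)
  let ?T0 = "window \<beta> 2" and ?T1 = "window \<beta> (2 - \<beta>)" and ?Z = "circle_sumset \<beta> X X"
  have ZL: "?Z \<in> lmeasurable"
    using open_circle_sumset[OF X(1)] by (intro lmeasurable_open_Ioo[of _ 0 \<beta>]) (auto simp: circle_sumset_def)
  have XS: "1 - x \<in> S" if "x \<in> X" for x using that by (simp add: X_def window_def)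
  have X_both: "X \<subseteq> ?T0 \<inter> ?T1"
  proof
    fix x assume x: "x \<in> X"
    have "(1 - x) + 1 \<in> S" "(1 - x) + c \<in> S" using XS[OF x] per by (auto simp: is_period_def)
    then have "2 - x \<in> S" "2 - \<beta> - x \<in> S" by (simp_all add: \<beta>_def algebra_simps)
    then show "x \<in> ?T0 \<inter> ?T1" using X(2) x by (auto simp: window_def)
  qed
  have Z_either: "?Z \<subseteq> ?T0 \<union> ?T1"
  proof
    fix z assume "z \<in> ?Z"
    then obtain x x' where z: "z \<in> {0<..<\<beta>}" "x \<in> X" "x' \<in> X" "z = x + x' \<or> z + \<beta> = x + x'"
      unfolding circle_sumset_def by blast
    have "(1 - x) + (1 - x') \<in> S" using XS z add by blast
    moreover have "(1 - x) + (1 - x') = 2 - z \<or> (1 - x) + (1 - x') = 2 - \<beta> - z" using z(4) by argo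
    ultimately have "2 - z \<in> S \<or> 2 - \<beta> - z \<in> S" by metis
    then show "z \<in> ?T0 \<union> ?T1" using z by (auto simp: window_def)
  qed
  have "min \<beta> (2 * W 1 1) \<le> measure lebesgue ?Z"
    using Raikov[OF X X] by (simp add: X_def)
  also have "\<dots> \<le> measure lebesgue (?T0 \<union> ?T1)"
    using Z_either ZL lmeasurable_window by (intro measure_mono_fmeasurable) auto
  finally have un: "min \<beta> (2 * W 1 1) \<le> measure lebesgue (?T0 \<union> ?T1)" .
  have int: "W 1 1 \<le> measure lebesgue (?T0 \<inter> ?T1)"
    using X_both XL lmeasurable_window unfolding X_def
    by (intro measure_mono_fmeasurable fmeasurable.Int) auto
  have "measure lebesgue (?T0 \<union> ?T1) = W \<beta> 2 + W \<beta> (2 - \<beta>) - measure lebesgue (?T0 \<inter> ?T1)"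
    using lmeasurable_window by (intro measure_Un3) auto
  moreover have "W \<beta> 2 + W \<beta> (2 - \<beta>) \<le> W 1 2"
  proof -
    let ?\<mu> = "\<lambda>a b. measure lebesgue (S \<inter> {a<..<b})"
    have "?\<mu> 1 2 = ?\<mu> 1 (2 - 2 * \<beta>) + ?\<mu> (2 - 2 * \<beta>) 2"
      using \<beta> by (intro measure_S_split) auto
    moreover have "?\<mu> (2 - 2 * \<beta>) 2 = ?\<mu> (2 - 2 * \<beta>) (2 - \<beta>) + ?\<mu> (2 - \<beta>) 2"
      using \<beta> by (intro measure_S_split) auto
    moreover have "0 \<le> ?\<mu> 1 (2 - 2 * \<beta>)" by simp
    ultimately show ?thesis by (simp add: W_eq algebra_simps)
  qed
  ultimately show ?thesis using un int by (simp add: \<beta>_def)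
qed

text \<open>Half of an \<open>\<alpha>\<close> is gained for each 2 in the argument of \<open>W 1\<close>. Up to \<open>K\<close> this happens at least
  four times, which is the \<open>2 \<alpha>\<close> that \<open>K \<alpha>\<close> may lack to exceed 1.\<close>
lemma mem_if_W_two_large:
  assumes per: "is_period 1" and \<alpha>: "\<alpha> \<le> W 1 1" "0 \<le> \<alpha>" "5/2 * \<alpha> \<le> W 1 2"
    and K: "K \<ge> 8" "(real K + 2) * \<alpha> > 1" and u: "real K \<le> u"
  shows "u \<in> S"
proof -
  define h where "h = K div 2"
  have h: "h \<ge> 4" using K by (simp add: h_def)
  have \<alpha>0: "\<alpha> > 0" using K \<alpha> by (cases "\<alpha> = 0") auto
  have h\<alpha>: "4 * \<alpha> \<le> real h * \<alpha>" using h \<alpha>0 by (intro mult_right_mono) auto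
  have hW: "real h * (5/2 * \<alpha>) \<le> real h * W 1 2" using \<alpha> by (intro mult_left_mono) auto
  show ?thesis
  proof (cases "even K")
    case True
    then have Kh: "real K = 2 * real h" unfolding h_def by (metis dvd_mult_div_cancel of_nat_mult of_nat_numeral)
    have "real h * W 1 2 > 1" using hW h\<alpha> K(2) unfolding Kh by (simp add: algebra_simps)
    then show ?thesis using mem_if_multiple_W_large[OF per, of 2 h u] u Kh by simp
  next
    case False
    then have "K = 2 * h + 1" unfolding h_def by presburger
    then have Kh: "real K = 2 * real h + 1" by simp
    have "min 1 (real h * W 1 2) \<le> W 1 (real h * 2)" using W_multiple[OF per, of 2 h] by simp
    moreover have "real h * W 1 2 + \<alpha> > 1" using hW h\<alpha> K(2) unfolding Kh by (simp add: algebra_simps)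
    ultimately have "W 1 (real h * 2) + W 1 1 > 1" using \<alpha> \<alpha>0 by linarith
    then show ?thesis using mem_if_W_large[OF per, of "real h * 2" 1 u] u Kh by simp
  qed
qed

text \<open>Only a measure of at most \<open>\<gamma>\<close> of \<open>(c, 1)\<close> is absent from \<open>S\<close>, at most a third of its length.
  Sums of two elements then fill \<open>(2 c, 2)\<close> up to margins \<open>2 \<gamma>\<close>, by pigeonhole. Sums of three do the
  same for \<open>(3 c, 3)\<close>: the translates by 1 and by \<open>c\<close> of the interval for two may leave a hole in the
  middle, which a third summand from inside \<open>(c, 1)\<close> closes. From then on these two translates overlap.\<close>
lemma dense_at_top_intervals:
  assumes per: "is_period 1" "is_period c" and c: "c < 1"
    and low: "\<And>s. s \<in> S \<Longrightarrow> c < s" and c0: "0 \<le> c"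
    and \<gamma>: "1 - c - \<gamma> \<le> W 1 1" "0 \<le> \<gamma>" "3 * \<gamma> \<le> 1 - c"
    and n: "n \<ge> 3" and v: "real n * c + 2 * \<gamma> < v" "v < real n - 2 * \<gamma>"
  shows "v \<in> S"
proof -
  have one: "s + 1 \<in> S" and c_add: "s + c \<in> S" if "s \<in> S" for s
    using that per by (auto simp: is_period_def)
  have big: "q - p - \<gamma> \<le> measure lebesgue (S \<inter> {p<..<q})" if "c \<le> p" "p \<le> q" "q \<le> 1" for p q
  proof -
    let ?\<mu> = "\<lambda>a b. measure lebesgue (S \<inter> {a<..<b})"
    have "?\<mu> 0 1 = ?\<mu> 0 c + ?\<mu> c 1" using c c0 by (intro measure_S_split) auto
    moreover have "S \<inter> {0<..<c} = {}" using low by fastforce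
    moreover have "?\<mu> c 1 = ?\<mu> c p + ?\<mu> p 1" using that by (intro measure_S_split) auto
    moreover have "?\<mu> p 1 = ?\<mu> p q + ?\<mu> q 1" using that by (intro measure_S_split) auto
    moreover have "?\<mu> c p \<le> p - c" "?\<mu> q 1 \<le> 1 - q" using that by (auto intro: measure_S_Ioo_le)
    ultimately show ?thesis using \<gamma>(1) by (simp add: W_eq)
  qed
  have two: "v \<in> S" if v: "2 * c + 2 * \<gamma> < v" "v < 2 - 2 * \<gamma>" for v
  proof -
    \<comment> \<open>The largest subinterval of \<open>(c, 1)\<close> that the reflection \<open>s \<mapsto> v - s\<close> maps onto itself.\<close>
    define p q where "p = max c (v - 1)" and "q = min 1 (v - c)"
    have pq: "c \<le> p" "p \<le> q" "q \<le> 1" "p + q = v" "q - p > 2 * \<gamma>"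
      using v c \<gamma> unfolding p_def q_def by (auto simp: max_def min_def)
    then have "(q - p) / 2 < measure lebesgue (S \<inter> {p<..<q})" using big[of p q] by (simp add: field_simps)
    then obtain s where "s \<in> S" "p + q - s \<in> S" using exists_complementary[of p q] pq by blast
    then have "s + (p + q - s) \<in> S" by (rule add)
    then show ?thesis using pq(4) by simp
  qed
  have three: "v \<in> S" if v: "3 * c + 2 * \<gamma> < v" "v < 3 - 2 * \<gamma>" for v
  proof -
    consider "2 * c + 1 + 2 * \<gamma> < v" | "v < 2 + c - 2 * \<gamma>"
      | "2 + c - 2 * \<gamma> \<le> v" "v \<le> 2 * c + 1 + 2 * \<gamma>" by linarith
    then show ?thesis
    proof cases
      case 1
      then show ?thesis using one[OF two[of "v - 1"]] v by simp
    next
      case 2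
      then show ?thesis using c_add[OF two[of "v - c"]] v by simp
    next
      case 3
      \<comment> \<open>For \<open>s\<close> in \<open>(p, q)\<close> the difference \<open>v - s\<close> lies in the interval filled by sums of two.\<close>
      define p q where "p = v - 2 + 2 * \<gamma>" and "q = v - 2 * c - 2 * \<gamma>"
      have pq: "c \<le> p" "p \<le> q" "q \<le> 1" "q - p > \<gamma>"
        using 3 c \<gamma> unfolding p_def q_def by linarith+
      then have "S \<inter> {p<..<q} \<noteq> {}" using big[of p q] by auto
      then obtain s where s: "s \<in> S" "p < s" "s < q" by auto
      then have "v - s \<in> S" by (intro two) (auto simp: p_def q_def)
      then have "s + (v - s) \<in> S" using s add by blast
      then show ?thesis by simp
    qed
  qed
  show ?thesis using n v
  proof (induction n arbitrary: v rule: dec_induct)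
    case base
    then show ?case using three[of v] by simp
  next
    case (step n)
    have split: "real n * c + 1 + 2 * \<gamma> < v \<or> v < real n + c - 2 * \<gamma>"
    proof -
      have "2 * (1 - c) \<le> (real n - 1) * (1 - c)" using step c by (intro mult_right_mono) auto
      then have "real n * c + 1 + 2 * \<gamma> < real n + c - 2 * \<gamma>" using \<gamma> c by (simp add: algebra_simps)
      then show ?thesis by linarith
    qed
    then show ?case
    proof
      assume "real n * c + 1 + 2 * \<gamma> < v"
      then show ?thesis using one[OF step.IH[of "v - 1"]] step.prems by simp
    next
      assume "v < real n + c - 2 * \<gamma>"
      then show ?thesis using c_add[OF step.IH[of "v - c"]] step.prems by (simp add: algebra_simps)
    qed
  qed
qed

text \<open>Equality holds for \<open>A = (1 - \<alpha>, 1)\<close>, whose sums with at most \<open>k\<close> summands fill only the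
  intervals \<open>(n - n \<alpha>, n)\<close>. The proof shows that a larger gap would force \<open>S \<inter> (0, 1)\<close> to be nearly such
  an interval, for which the bound is checked directly. Throughout, \<open>u \<ge> k - 1\<close>, so no two windows whose
  ends sum to \<open>k - 1\<close> can together exceed their period.\<close>
lemma sharp_gap_bound:
  assumes per: "is_period 1" and \<alpha>: "\<alpha> \<le> W 1 1"
    and k: "k \<ge> 10" "real k * \<alpha> \<le> 1" "1 < (real k + 1) * \<alpha>" and u: "u \<notin> S"
  shows "u \<le> real k * (1 - \<alpha>)"
proof (rule ccontr)
  assume "\<not> ?thesis"
  then have u_gt: "real k - real k * \<alpha> < u" by (simp add: algebra_simps)
  have \<alpha>0: "\<alpha> > 0"
  proof (rule ccontr)
    assume "\<not> ?thesis"
    then have "(real k + 1) * \<alpha> \<le> 0" by (simp add: mult_nonneg_nonpos)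
    then show False using k(3) by linarith
  qed
  define K where "K = k - 1"
  have K: "real K = real k - 1" "K \<ge> 9" using k unfolding K_def by auto
  have Ku: "real K \<le> u" using u_gt k K by linarith
  have K\<alpha>: "(real K + 2) * \<alpha> > 1"
  proof -
    have "real K + 2 = real k + 1" using K(1) by simp
    then show ?thesis using k(3) by metis
  qed
  have no_small: "1/2 < y" if y: "y \<in> S" for y
  proof (rule ccontr)
    assume "\<not> ?thesis"
    then have y': "y \<le> 1/2" "0 \<le> y" using pos[OF y] by auto
    have "\<alpha> \<le> y / real K + (1 - y / 2)\<^sup>2 / (2 * (real K - 1))"
      using small_element_density[OF y y'(1) _ Ku u] K \<alpha> by simp
    also have "\<dots> < 1 / (real K + 2)" using y' K by (intro small_element_estimate) auto
    finally show False using K\<alpha> by (simp add: field_simps)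
  qed
  define A where "A = S \<inter> {0<..<1}"
  have "window 1 1 \<noteq> {}" using window_nonempty_iff[of 1 1] \<alpha> \<alpha>0 by linarith
  then have A: "A \<noteq> {}" unfolding A_def window_def by auto
  have A_bdd: "bdd_below A" by (intro bdd_belowI[of _ 0]) (simp add: A_def)
  define c where "c = Inf A"
  have c_half: "1/2 \<le> c"
    unfolding c_def
  proof (rule cInf_greatest[OF A])
    fix x assume "x \<in> A"
    then show "1/2 \<le> x" using no_small[of x] by (simp add: A_def)
  qed
  have openA: "open A" unfolding A_def using open_S by (intro open_Int) auto
  have c_low: "c < s" if s: "s \<in> A" for s
  proof -
    obtain e where e: "e > 0" "ball s e \<subseteq> A" using openA s open_contains_ball[of A] by blast
    have "s - e / 2 \<in> ball s e" using e(1) by (simp add: dist_real_def)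
    then have "c \<le> s - e / 2" unfolding c_def using e(2) A_bdd by (intro cInf_lower) auto
    then show ?thesis using e(1) by linarith
  qed
  have c1: "c < 1"
  proof -
    obtain s where s: "s \<in> A" using A by blast
    have "s < 1" using s by (simp add: A_def)
    with c_low[OF s] show ?thesis by linarith
  qed
  have low: "c < s" if "s \<in> S" for s
    using c_low[of s] that c1 pos[OF that] unfolding A_def by (cases "s < 1") auto
  have "c \<in> closure A" unfolding c_def using A A_bdd by (rule closure_contains_Inf)
  then have "c \<in> closure S" using closure_mono[of A S] unfolding A_def by blast
  then have per_c: "is_period c" using c_half by (intro is_period_closure) auto
  have W_pos: "W 1 1 > 0" using \<alpha> \<alpha>0 by linarith
  have W_le_c: "W 1 1 \<le> 1 - c"
  proof -
    have "S \<inter> {0<..<1} \<subseteq> {c<..<1}" using low by auto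
    then have "W 1 1 \<le> measure lebesgue {c<..<1}"
      using lmeasurable_S_Ioo[of 0 1] unfolding W_eq by (intro measure_mono_fmeasurable) auto
    then show ?thesis using c1 by simp
  qed
  show False
  proof (cases "3/2 * \<alpha> < 1 - c")
    case True
    have "W 1 1 + min (1 - c) (2 * W 1 1) \<le> W 1 2"
      by (rule W_two_ge[OF per per_c c_half c1 _ W_pos]) (rule low)
    then have "5/2 * \<alpha> \<le> W 1 2" using True \<alpha> \<alpha>0 by linarith
    then have "u \<in> S" using mem_if_W_two_large[OF per \<alpha> _ _ _ K\<alpha> Ku] \<alpha>0 K by simp
    then show False using u by simp
  next
    case False
    define \<gamma> where "\<gamma> = 1 - c - \<alpha>"
    have \<gamma>: "1 - c - \<gamma> \<le> W 1 1" "0 \<le> \<gamma>" "3 * \<gamma> \<le> 1 - c"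
      using False \<alpha> W_le_c by (simp_all add: \<gamma>_def)
    have mem: "v \<in> S" if "n \<ge> 3" "real n * c + 2 * \<gamma> < v" "v < real n - 2 * \<gamma>" for n v
      by (rule dense_at_top_intervals[OF per per_c c1 _ _ \<gamma> that]) (use low c_half in simp_all)
    have c_eq: "c = 1 - \<alpha> - \<gamma>" by (simp add: \<gamma>_def)
    have k\<gamma>: "10 * \<gamma> \<le> real k * \<gamma>" using k(1) \<gamma>(2) by (intro mult_right_mono) auto
    have uk: "u < real k"
    proof -
      have "u \<le> real k * (2 - (real k + 1) * \<alpha>)"
        using k \<alpha>0 by (intro gap_bound[OF per \<alpha>] u) auto
      also have "\<dots> < real k * 1" using k by (intro mult_strict_left_mono) auto
      finally show ?thesis by simp
    qed
    show False
    proof (cases "u < real k - 2 * \<gamma>")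
      case True
      have "real k * c + 2 * \<gamma> = real k - real k * \<alpha> - (real k * \<gamma> - 2 * \<gamma>)"
        by (simp add: c_eq algebra_simps)
      then have "real k * c + 2 * \<gamma> < u" using u_gt k\<gamma> \<gamma>(2) by linarith
      then show False using mem[of k u] True k u by simp
    next
      case False
      \<comment> \<open>Here \<open>u\<close> is too close to \<open>k\<close> for sums of \<open>k\<close> elements, but \<open>(k + 1) \<alpha> > 1\<close> makes sums of
        \<open>k + 1\<close> elements reach below \<open>k\<close>.\<close>
      have "real (Suc k) * c + 2 * \<gamma> = (real k + 1) - (real k + 1) * \<alpha> - (real k * \<gamma> - \<gamma>)"
        by (simp add: c_eq algebra_simps)
      then have "real (Suc k) * c + 2 * \<gamma> < u" using False k(3) k\<gamma> \<gamma>(2) by linarith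
      moreover have "u < real (Suc k) - 2 * \<gamma>" using uk \<gamma>(3) c_half by simp
      ultimately show False using mem[of "Suc k" u] k u by simp
    qed
  qed
qed

end

section \<open>The semigroup of finite sums\<close>

lemma hfold_sumset_0: "hfold_sumset 0 A = {0}"
  by (auto simp: hfold_sumset_def)

lemma hfold_sumset_Suc:
  "hfold_sumset (Suc h) A = (\<Union>x\<in>hfold_sumset h A. \<Union>y\<in>A. {x + y})"
proof (intro equalityI subsetI)
  fix u assume "u \<in> hfold_sumset (Suc h) A"
  then obtain a where "\<forall>i<Suc h. a i \<in> A" "u = (\<Sum>i<h. a i) + a h"
    unfolding hfold_sumset_def by auto
  moreover from this have "(\<Sum>i<h. a i) \<in> hfold_sumset h A" "a h \<in> A"
    unfolding hfold_sumset_def by auto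
  ultimately show "u \<in> (\<Union>x\<in>hfold_sumset h A. \<Union>y\<in>A. {x + y})" by blast
next
  fix u assume "u \<in> (\<Union>x\<in>hfold_sumset h A. \<Union>y\<in>A. {x + y})"
  then obtain a y where a: "\<forall>i<h. a i \<in> A" "y \<in> A" "u = (\<Sum>i<h. a i) + y"
    unfolding hfold_sumset_def by auto
  have "u = (\<Sum>i<Suc h. (a(h := y)) i)" using a(3) by simp
  moreover have "\<forall>i<Suc h. (a(h := y)) i \<in> A" using a by auto
  ultimately show "u \<in> hfold_sumset (Suc h) A" unfolding hfold_sumset_def by blast
qed

lemma hfold_sumset_add:
  assumes "x \<in> hfold_sumset m A" "y \<in> hfold_sumset n A"
  shows "x + y \<in> hfold_sumset (m + n) A"
  using assms(2)
proof (induction n arbitrary: y)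
  case 0
  then show ?case using assms(1) by (simp add: hfold_sumset_0)
next
  case (Suc n)
  then obtain z a where z: "z \<in> hfold_sumset n A" "a \<in> A" "y = z + a"
    by (auto simp: hfold_sumset_Suc)
  have "(x + z) + a \<in> hfold_sumset (Suc (m + n)) A"
    using Suc.IH[OF z(1)] z(2) unfolding hfold_sumset_Suc by blast
  then show ?case using z(3) by (simp add: add.assoc)
qed

lemma subset_finite_sums: "A \<subseteq> finite_sums A"
proof
  fix a assume "a \<in> A"
  then have "a \<in> hfold_sumset (Suc 0) A" by (simp add: hfold_sumset_Suc hfold_sumset_0)
  then show "a \<in> finite_sums A" by (auto simp: finite_sums_def)
qed

lemma open_semigroup_finite_sums:
  assumes "open A" "A \<subseteq> {0<..<1}"
  shows "open_semigroup (finite_sums A)"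
proof
  have "open (hfold_sumset h A)" if h: "h \<in> {1..}" for h
  proof -
    obtain g where "h = Suc g" using h by (cases h) auto
    then show ?thesis using open_sums[of "hfold_sumset g A" A] assms(1) by (simp add: hfold_sumset_Suc)
  qed
  then show "open (finite_sums A)" unfolding finite_sums_def by (intro open_UN) auto
next
  fix s assume "s \<in> finite_sums A"
  then show "s > 0" by (rule finite_sums_pos[OF assms(2)])
next
  fix s t assume "s \<in> finite_sums A" "t \<in> finite_sums A"
  then obtain m n where "m \<ge> 1" "s \<in> hfold_sumset m A" "t \<in> hfold_sumset n A"
    unfolding finite_sums_def by auto
  then have "s + t \<in> hfold_sumset (m + n) A" "m + n \<in> {1..}" by (auto intro: hfold_sumset_add)
  then show "s + t \<in> finite_sums A" unfolding finite_sums_def by blast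
qed

text \<open>Dividing by \<open>\<sigma> = Sup A\<close> makes 1 a period and can only increase the measure in \<open>(0, 1)\<close>.\<close>
lemma rescaled_semigroup:
  assumes A: "open A" "A \<subseteq> {0<..<1}" "A \<noteq> {}"
  obtains S \<sigma> where "open_semigroup S" "0 < \<sigma>" "\<sigma> \<le> 1"
    "\<And>x. x \<in> S \<longleftrightarrow> \<sigma> * x \<in> finite_sums A" "open_semigroup.is_period S 1"
    "measure lebesgue A \<le> measure lebesgue (open_semigroup.window S 1 1)"
proof -
  interpret F: open_semigroup "finite_sums A" by (rule open_semigroup_finite_sums[OF A(1,2)])
  define \<sigma> where "\<sigma> = Sup A"
  have bdd: "bdd_above A" using A(2) by (intro bdd_aboveI[of _ 1]) force
  have lt: "a < \<sigma>" if a: "a \<in> A" for a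
  proof -
    obtain e where e: "e > 0" "ball a e \<subseteq> A" using A(1) a open_contains_ball[of A] by blast
    have "a + e / 2 \<in> ball a e" using e(1) by (simp add: dist_real_def)
    then have "a + e / 2 \<le> \<sigma>" unfolding \<sigma>_def using e(2) bdd by (intro cSup_upper) auto
    then show ?thesis using e(1) by linarith
  qed
  have \<sigma>0: "0 < \<sigma>" using A lt by force
  have \<sigma>1: "\<sigma> \<le> 1" unfolding \<sigma>_def using A by (intro cSup_least) force+
  have "\<sigma> \<in> closure A" unfolding \<sigma>_def using A(3) bdd by (rule closure_contains_Sup)
  then have "\<sigma> \<in> closure (finite_sums A)" using closure_mono[OF subset_finite_sums] by blast
  then have per: "F.is_period \<sigma>" using \<sigma>0 by (intro F.is_period_closure)
  define S where "S = {x. \<sigma> * x \<in> finite_sums A}"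
  interpret S: open_semigroup S
  proof
    show "open S" unfolding S_def
      using open_vimage[OF F.open_S, of "\<lambda>x. \<sigma> * x"] by (simp add: vimage_def continuous_intros)
    show "s > 0" if "s \<in> S" for s
      using F.pos[of "\<sigma> * s"] that \<sigma>0 by (simp add: S_def zero_less_mult_iff)
    show "s + t \<in> S" if "s \<in> S" "t \<in> S" for s t
      using F.add that by (simp add: S_def distrib_left)
  qed
  have "S.is_period 1"
    unfolding S.is_period_def
    using per by (simp add: F.is_period_def S_def distrib_left)
  moreover have "measure lebesgue A \<le> S.W 1 1"
  proof -
    have sub: "(\<lambda>x. (1 / \<sigma>) *\<^sub>R x + 0) ` A \<subseteq> S \<inter> {0<..<1}"
    proof clarify
      fix a assume a: "a \<in> A"
      then have "0 < a" "a < \<sigma>" using lt A by auto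
      then show "(1 / \<sigma>) *\<^sub>R a + 0 \<in> S \<inter> {0<..<1}"
        using a \<sigma>0 subset_finite_sums by (auto simp: S_def)
    qed
    have "(\<lambda>x. (1 / \<sigma>) *\<^sub>R x + 0) ` A = (\<lambda>x. \<sigma> * x) -` A"
      using \<sigma>0 by (force simp: image_iff)
    then have "open ((\<lambda>x. (1 / \<sigma>) *\<^sub>R x + 0) ` A)"
      using open_vimage[OF A(1), of "\<lambda>x. \<sigma> * x"] by (simp add: continuous_intros)
    then have "(\<lambda>x. (1 / \<sigma>) *\<^sub>R x + 0) ` A \<in> lmeasurable"
      using sub by (intro lmeasurable_open_Ioo[of _ 0 1]) auto
    then have "measure lebesgue ((\<lambda>x. (1 / \<sigma>) *\<^sub>R x + 0) ` A) \<le> measure lebesgue (S \<inter> {0<..<1})"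
      using sub S.lmeasurable_S_Ioo by (intro measure_mono_fmeasurable) auto
    then have "1 / \<sigma> * measure lebesgue A \<le> S.W 1 1"
      using \<sigma>0 measure_lebesgue_affine[of "1 / \<sigma>" 0 A] by (simp add: S.W_eq)
    moreover have "1 * measure lebesgue A \<le> 1 / \<sigma> * measure lebesgue A"
      using \<sigma>0 \<sigma>1 by (intro mult_right_mono) auto
    ultimately show ?thesis by simp
  qed
  ultimately show thesis
    using that[of S \<sigma>] S.open_semigroup_axioms \<sigma>0 \<sigma>1 by (simp add: S_def)
qed

text \<open>Undoing the scaling multiplies a gap by \<open>\<sigma> \<le> 1\<close>, so a nonnegative bound survives it.\<close>
lemma G_le:
  assumes A: "open A" "A \<subseteq> {0<..<1}" "A \<noteq> {}" and b: "b \<ge> 0"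
    and bound: "\<And>S u. \<lbrakk>open_semigroup S; open_semigroup.is_period S 1;
      measure lebesgue A \<le> measure lebesgue (open_semigroup.window S 1 1); u \<notin> S\<rbrakk> \<Longrightarrow> u \<le> b"
  shows "G A \<le> b"
  unfolding G_def
proof (rule cSup_least[OF nonrep_nonempty[OF A(2)]])
  fix u assume u: "u \<in> {u. u \<notin> finite_sums A}"
  obtain S \<sigma> where S: "open_semigroup S" "open_semigroup.is_period S 1"
      "measure lebesgue A \<le> measure lebesgue (open_semigroup.window S 1 1)"
    and \<sigma>: "0 < \<sigma>" "\<sigma> \<le> 1" and mem: "\<And>x. x \<in> S \<longleftrightarrow> \<sigma> * x \<in> finite_sums A"
    using rescaled_semigroup[OF A] by blast
  have "u / \<sigma> \<notin> S" using u \<sigma> by (simp add: mem)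
  then have "u / \<sigma> \<le> b" using bound S by blast
  then have "u \<le> b * \<sigma>" using \<sigma> by (simp add: field_simps)
  also have "\<dots> \<le> b" using \<sigma> b by (simp add: mult_left_le)
  finally show "u \<le> b" .
qed

theorem mainTheorem1:
  fixes A :: "real set" and \<alpha> :: real
  assumes "open A"
    and "A \<subseteq> {0<..<1}"
    and "measure lebesgue A = \<alpha>"
    and "0 < \<alpha>" and "\<alpha> \<le> 1"
  shows "(0 < \<alpha> \<and> \<alpha> \<le> 0.1 \<longrightarrow> G A \<le> (1 - \<alpha>) * of_int \<lfloor>1 / \<alpha>\<rfloor>) \<and>
    (0.1 \<le> \<alpha> \<and> \<alpha> \<le> 0.5 \<longrightarrow> G A \<le> (1 - \<alpha> + \<alpha> * frac (1 / \<alpha>)) * of_int \<lfloor>1 / \<alpha>\<rfloor>) \<and>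
    (0.5 \<le> \<alpha> \<and> \<alpha> \<le> 1 \<longrightarrow> G A \<le> 2 * (1 - \<alpha>))"
proof -
  have ne: "A \<noteq> {}" using assms(3,4) by auto
  define k where "k = nat \<lfloor>1 / \<alpha>\<rfloor>"
  have "1 / \<alpha> \<ge> 1" using assms(4,5) by simp
  then have fl: "of_int \<lfloor>1 / \<alpha>\<rfloor> = real k" and k1: "k \<ge> 1" unfolding k_def by linarith+
  have "real k \<le> 1 / \<alpha>" "1 / \<alpha> < real k + 1" unfolding fl[symmetric] by linarith+
  then have k\<alpha>: "real k * \<alpha> \<le> 1" "1 < (real k + 1) * \<alpha>" using assms(4) by (simp_all add: field_simps)
  have general: "G A \<le> real k * (2 - (real k + 1) * \<alpha>)"
  proof (rule G_le[OF assms(1,2) ne])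
    have "(real k + 1) * \<alpha> = real k * \<alpha> + \<alpha>" by (simp add: algebra_simps)
    then show "0 \<le> real k * (2 - (real k + 1) * \<alpha>)" using k\<alpha>(1) assms(5) by simp
  qed (use open_semigroup.gap_bound[of _ \<alpha> k] assms(3,4) k1 k\<alpha> in simp)
  have "G A \<le> (1 - \<alpha>) * of_int \<lfloor>1 / \<alpha>\<rfloor>" if "\<alpha> \<le> 0.1"
  proof -
    have "1 / \<alpha> \<ge> 10" using that assms(4) by (simp add: field_simps)
    then have k10: "k \<ge> 10" unfolding k_def by linarith
    have "G A \<le> real k * (1 - \<alpha>)"
    proof (rule G_le[OF assms(1,2) ne])
      show "0 \<le> real k * (1 - \<alpha>)" using assms(5) by simp
    qed (use open_semigroup.sharp_gap_bound[of _ \<alpha> k] assms(3) k10 k\<alpha> in simp)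
    then show ?thesis by (simp add: fl mult.commute)
  qed
  moreover have "G A \<le> (1 - \<alpha> + \<alpha> * frac (1 / \<alpha>)) * of_int \<lfloor>1 / \<alpha>\<rfloor>"
  proof -
    have frac_eq: "frac (1 / \<alpha>) = 1 / \<alpha> - real k" by (simp add: frac_def fl)
    have \<alpha>_frac: "\<alpha> * frac (1 / \<alpha>) = 1 - real k * \<alpha>"
      unfolding frac_eq using assms(4) by (simp add: right_diff_distrib)
    have eq: "(1 - \<alpha> + \<alpha> * frac (1 / \<alpha>)) * real k = real k * (2 - (real k + 1) * \<alpha>)"
      unfolding \<alpha>_frac by (simp add: algebra_simps)
    show ?thesis unfolding fl eq by (rule general)
  qed
  moreover have "G A \<le> 2 * (1 - \<alpha>)" if "0.5 \<le> \<alpha>"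
  proof (cases "\<alpha> = 1/2")
    case True
    have "k = 2" unfolding k_def True by simp
    then show ?thesis using general True by simp
  next
    case False
    have "1 / \<alpha> < 2" using False that by (simp add: field_simps)
    then have "k = 1" using k1 unfolding k_def by linarith
    then show ?thesis using general by simp
  qed
  ultimately show ?thesis by blast
qed

end
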